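(* Let $q\in(0,1)$, $\nu>-1$ and let $f\in\mathcal{R}$ be of the form $f(z)=z+\sum_{n\geq2}a_nz^n$. The following statements hold. (a) If $4(1-q)(1-q^{\nu})-3q^{\nu}>0$, then the Hadamard product $u(z)=h_{\nu}^{(2)}(z;q)*f(z)$ belongs to $\mathcal{H}^{\infty}\cap\mathcal{R}$. (b) If $(1-q)(1-q^{\nu})-3\sqrt{q}>0$, then the Hadamard product $v(z)=h_{\nu}^{(3)}(z;q)*f(z)$ belongs to $\mathcal{H}^{\infty}\cap\mathcal{R}$.
   Context: $\mathbb{U}=\{z\in\mathbb{C}:|z|<1\}$. $\mathcal{A}$ is the class of analytic functions $f:\mathbb{U}\to\mathbb{C}$ of the form $f(z)=z+\sum_{n\geq2}a_nz^n$. $\mathcal{R}$ is the class of $f\in\mathcal{A}$ with $\operatorname{Re}f'(z)>0$ for all $z\in\mathbb{U}$. $\mathcal{H}^\infty$ is the class of bounded analytic functions in $\mathbb{U}$. The Hadamard product (convolution) of $f_1(z)=z+\sum_{n\geq2}a_nz^n$ and $f_2(z)=z+\sum_{n\geq2}b_nz^n$ is $(f_1*f_2)(z)=z+\sum_{n\geq2}a_nb_nz^n$. For $q\in(0,1)$: $(a;q)_0=1$ and $(a;q)_n=\prod_{k=1}^{n}(1-aq^{k-1})$. The normalized Jackson second and third $q$-Bessel functions are, for $\nu>-1$, $$h_{\nu}^{(2)}(z;q)=z+\sum_{n\geq2}\frac{(-1)^{n-1}q^{(n-1)(n-1+\nu)}}{4^{n-1}(q;q)_{n-1}(q^{\nu+1};q)_{n-1}}z^{n},\qquad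 h_{\nu}^{(3)}(z;q)=z+\sum_{n\geq2}\frac{(-1)^{n-1}q^{\frac{1}{2}(n-1)n}}{(q;q)_{n-1}(q^{\nu+1};q)_{n-1}}z^{n}.$$ *)

theory Defs
  imports "HOL-Complex_Analysis.Complex_Analysis"
begin

abbreviation unit_disk :: "complex set" where
  "unit_disk \<equiv> ball 0 1"

(* f(z) = z + (sum over n >= 2 of a_n z^n) on the unit disk; a 0 and a 1 are irrelevant. *)
definition normalized_series :: "(complex \<Rightarrow> complex) \<Rightarrow> (nat \<Rightarrow> complex) \<Rightarrow> bool" where
  "normalized_series f a \<longleftrightarrow>
     (\<forall>z\<in>unit_disk. (\<lambda>n. a (n + 2) * z ^ (n + 2)) sums (f z - z))"

(* Elements are total functions; their values outside the unit disk are irrelevant. *)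
definition class_A :: "(complex \<Rightarrow> complex) set" where
  "class_A = {f. f analytic_on unit_disk \<and> (\<exists>a. normalized_series f a)}"

definition class_R :: "(complex \<Rightarrow> complex) set" where
  "class_R = {f \<in> class_A. \<forall>z\<in>unit_disk. Re (deriv f z) > 0}"

definition H_infinity :: "(complex \<Rightarrow> complex) set" where
  "H_infinity = {f. f analytic_on unit_disk \<and> bounded (f ` unit_disk)}"

(* The coefficients of the factors are read off as Taylor coefficients at 0;
   see hadamard_product_eq for the usual form. *)
definition hadamard_product ::
  "(complex \<Rightarrow> complex) \<Rightarrow> (complex \<Rightarrow> complex) \<Rightarrow> complex \<Rightarrow> complex" where
  "hadamard_product f g = (\<lambda>z. z + (\<Sum>n.
     fps_nth (fps_expansion f 0) (n + 2) * fps_nth (fps_expansion g 0) (n + 2) * z ^ (n + 2)))"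

definition q_pochhammer :: "real \<Rightarrow> real \<Rightarrow> nat \<Rightarrow> real" where
  "q_pochhammer a q n = (\<Prod>k = 1..n. 1 - a * q ^ (k - 1))"

definition h2_coeff :: "real \<Rightarrow> real \<Rightarrow> nat \<Rightarrow> real" where
  "h2_coeff \<nu> q n =
     (-1) ^ (n - 1) * q powr (real (n - 1) * (real (n - 1) + \<nu>)) /
     (4 ^ (n - 1) * q_pochhammer q q (n - 1) * q_pochhammer (q powr (\<nu> + 1)) q (n - 1))"

definition h3_coeff :: "real \<Rightarrow> real \<Rightarrow> nat \<Rightarrow> real" where
  "h3_coeff \<nu> q n =
     (-1) ^ (n - 1) * q powr (1 / 2 * real (n - 1) * real n) /
     (q_pochhammer q q (n - 1) * q_pochhammer (q powr (\<nu> + 1)) q (n - 1))"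

definition h2 :: "real \<Rightarrow> real \<Rightarrow> complex \<Rightarrow> complex" where
  "h2 \<nu> q z = z + (\<Sum>n. complex_of_real (h2_coeff \<nu> q (n + 2)) * z ^ (n + 2))"

definition h3 :: "real \<Rightarrow> real \<Rightarrow> complex \<Rightarrow> complex" where
  "h3 \<nu> q z = z + (\<Sum>n. complex_of_real (h3_coeff \<nu> q (n + 2)) * z ^ (n + 2))"

lemma normalized_series_coeff:
  assumes "normalized_series f a" and "n \<ge> 2"
  shows "fps_nth (fps_expansion f 0) n = a n"
proof -
  define b where "b n = (if n = 0 then 0 else if n = 1 then 1 else a n)" for n
  have sums: "(\<lambda>n. b n * z ^ n) sums f z" if "z \<in> unit_disk" for z
  proof -
    have "(\<lambda>n. b (n + 2) * z ^ (n + 2)) sums (f z - (\<Sum>i<2. b i * z ^ i))"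
      using assms(1) that unfolding normalized_series_def b_def
      by (auto simp: numeral_2_eq_2)
    thus ?thesis by (subst (asm) sums_iff_shift) simp
  qed
  have "ereal 1 \<le> conv_radius b"
  proof (rule conv_radius_geI_ex)
    fix r :: real assume "0 < r" "ereal r < ereal 1"
    then show "\<exists>z. norm z = r \<and> summable (\<lambda>n. b n * z ^ n)"
      using sums[of "of_real r"] by (intro exI[of _ "of_real r"]) (auto simp: sums_iff)
  qed
  then have "fps_conv_radius (Abs_fps b) > 0"
    by (auto simp: fps_conv_radius_def zero_ereal_def one_ereal_def
        intro: less_le_trans[of _ 1])
  moreover have "eventually (\<lambda>z. z \<in> unit_disk) (nhds 0)"
    by (rule eventually_nhds_in_open) auto
  then have "eventually (\<lambda>z. eval_fps (Abs_fps b) z = f z) (nhds 0)"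
    by eventually_elim (use sums in \<open>auto simp: eval_fps_def sums_iff\<close>)
  ultimately have "f has_fps_expansion Abs_fps b"
    by (simp add: has_fps_expansion_def)
  then have "fps_expansion f 0 = Abs_fps b"
    by (rule fps_expansion_eqI)
  thus ?thesis using assms(2) by (simp add: b_def)
qed

lemma hadamard_product_eq:
  assumes "normalized_series f a" and "normalized_series g b"
  shows "hadamard_product f g z = z + (\<Sum>n. a (n + 2) * b (n + 2) * z ^ (n + 2))"
  using assms by (simp add: hadamard_product_def normalized_series_coeff)

end

theory Submission
  imports Defs
begin

text \<open>
  If \<open>h z = z + \<Sum> c\<^sub>n z\<^sup>n\<^sup>+\<^sup>1\<close> and \<open>u\<close> is the Hadamard product of \<open>h\<close> and \<open>f\<close>, then the coefficients of
  \<open>u'\<close> are the products of those of \<open>h z / z\<close> and \<open>f'\<close>. Caratheodory's inequality bounds the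
  coefficients of \<open>f'\<close> by 2, so \<open>\<bar>u' z - 1\<bar> \<le> 2 \<Sum> \<bar>c\<^sub>n\<bar>\<close>, and it suffices that this bound is less than 1.
  For both q-Bessel functions the hypothesis gives \<open>\<bar>c\<^sub>n\<bar> \<le> x\<^sup>n\<close> with \<open>x < 1/3\<close>, and \<open>2 x / (1 - x) < 1\<close>.
\<close>

section \<open>Caratheodory's coefficient inequality\<close>

text \<open>
  For \<open>n > 0\<close> the \<open>n\<close>-th Fourier coefficient of \<open>cnj p\<close> on a circle vanishes, so that of \<open>p\<close> equals that
  of \<open>2 Re p \<ge> 0\<close>, which is bounded by the mean \<open>2 Re (p 0) = 2\<close>.
\<close>

lemma Caratheodory_coefficient_bound:
  fixes p :: "complex \<Rightarrow> complex"
  assumes holo: "p holomorphic_on ball 0 1" and p0: "p 0 = 1"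
    and pos: "\<And>z. z \<in> ball 0 1 \<Longrightarrow> Re (p z) \<ge> 0" and n: "n > 0"
  shows "norm ((deriv ^^ n) p 0 / fact n) \<le> 2"
proof -
  define c where "c = (deriv ^^ n) p 0 / fact n"
  \<comment> \<open>\<open>p\<close> is controlled only inside the open disk, so the estimate is
    made on a circle of radius \<open>r < 1\<close>; letting \<open>r\<close> tend to 1 then removes
    the factor \<open>r ^ n\<close>.\<close>
  have bound: "norm c * r ^ n \<le> 2" if r: "0 < r" "r < 1" for r :: real
  proof -
    have holr: "p holomorphic_on ball 0 r"
      using holo by (rule holomorphic_on_subset) (use r in auto)
    have contr: "continuous_on (cball 0 r) p"
      using holo by (intro holomorphic_on_imp_continuous_on, rule holomorphic_on_subset)
        (use r in auto)
    define g where "g = (\<lambda>t. p (complex_of_real r * cis t))"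
    \<comment> \<open>Cauchy's formula for derivatives, read as a Fourier coefficient on the circle.
      It is stated for arbitrary \<open>f\<close> because it serves both \<open>p\<close> and
      \<open>p u * u ^ n\<close>.\<close>
    have Cauchy: "((\<lambda>t. f (complex_of_real r * cis t) * cis (- (real k * t))) has_integral
             of_real (2 * pi * r ^ k) * ((deriv ^^ k) f 0 / fact k)) {0..2*pi}"
      if "continuous_on (cball 0 r) f" "f holomorphic_on ball 0 r" for f k
    proof -
      have "((\<lambda>u. f u / (u - 0) ^ Suc k) has_contour_integral
              (2 * pi * \<i>) / fact k * (deriv ^^ k) f 0) (circlepath 0 r)"
        using that r by (intro Cauchy_has_contour_integral_higher_derivative_circlepath) auto
      then have "((\<lambda>t. f (0 + r * cis t) / (0 + r * cis t - 0) ^ Suc k * r * \<i> * cis t)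
          has_integral (2 * pi * \<i>) / fact k * (deriv ^^ k) f 0) {0..2*pi}"
        unfolding circlepath_def by (subst (asm) has_contour_integral_part_circlepath_iff) auto
      \<comment> \<open>On the circle \<open>du = \<i> u dt\<close>, so the factor
        \<open>r ^ k / \<i>\<close> turns \<open>du / u ^ Suc k\<close> into
        \<open>cis (- (real k * t)) dt\<close>.\<close>
      then have "((\<lambda>t. (r ^ k / \<i>) *
          (f (0 + r * cis t) / (0 + r * cis t - 0) ^ Suc k * r * \<i> * cis t))
          has_integral (r ^ k / \<i>) * ((2 * pi * \<i>) / fact k * (deriv ^^ k) f 0)) {0..2*pi}"
        by (rule has_integral_mult_right)
      moreover have "(r ^ k / \<i>) *
          (f (0 + r * cis t) / (0 + r * cis t - 0) ^ Suc k * r * \<i> * cis t)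
          = f (r * cis t) * cis (- (real k * t))" for t
      proof -
        have "cis (- (real k * t)) = inverse (cis t ^ k)"
          unfolding Complex.DeMoivre by (rule cis_inverse [symmetric])
        then show ?thesis using r by (simp add: field_simps power_mult_distrib)
      qed
      ultimately show ?thesis
        by (simp add: field_simps)
    qed
    have I0: "(g has_integral of_real (2 * pi)) {0..2*pi}"
      using Cauchy[OF contr holr, of 0] by (simp add: g_def p0)
    have I1: "((\<lambda>t. g t * cis (- (real n * t))) has_integral of_real (2 * pi * r ^ n) * c) {0..2*pi}"
      using Cauchy[OF contr holr, of n] by (simp add: g_def c_def)
    \<comment> \<open>The function \<open>p u * u ^ n\<close> vanishes at 0 since
      \<open>n > 0\<close>, so its mean over the circle is 0; conjugating this gives the vanishing
      coefficient of \<open>cnj p\<close>.\<close>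
    have "continuous_on (cball 0 r) (\<lambda>u. p u * u ^ n)"
      by (intro continuous_intros contr)
    moreover have "(\<lambda>u. p u * u ^ n) holomorphic_on ball 0 r"
      by (intro holomorphic_intros holr)
    ultimately have "((\<lambda>t. p (r * cis t) * (r * cis t) ^ n) has_integral 0) {0..2*pi}"
      using Cauchy[of "\<lambda>u. p u * u ^ n" 0] n by (simp add: zero_power)
    then have "((\<lambda>t. inverse (of_real r ^ n) * (p (r * cis t) * (r * cis t) ^ n))
        has_integral inverse (of_real r ^ n) * 0) {0..2*pi}"
      by (rule has_integral_mult_right)
    then have "((\<lambda>t. g t * cis (real n * t)) has_integral 0) {0..2*pi}"
      using r by (simp add: g_def power_mult_distrib Complex.DeMoivre field_simps)
    then have "((cnj \<circ> (\<lambda>t. g t * cis (real n * t))) has_integral cnj 0) {0..2*pi}"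
      by (subst has_integral_cnj)
    then have I2: "((\<lambda>t. cnj (g t) * cis (- (real n * t))) has_integral 0) {0..2*pi}"
      by (simp add: o_def cis_cnj)
    have "((\<lambda>t. g t * cis (- (real n * t)) + cnj (g t) * cis (- (real n * t)))
        has_integral of_real (2 * pi * r ^ n) * c + 0) {0..2*pi}"
      by (rule has_integral_add[OF I1 I2])
    moreover have "g t * cis s + cnj (g t) * cis s = of_real (2 * Re (g t)) * cis s" for t s
      by (metis complex_add_cnj distrib_right)
    ultimately have I3: "((\<lambda>t. of_real (2 * Re (g t)) * cis (- (real n * t)))
        has_integral of_real (2 * pi * r ^ n) * c) {0..2*pi}"
      by simp
    have I4: "((\<lambda>t. 2 * Re (g t)) has_integral 2 * (2 * pi)) {0..2*pi}"
      using has_integral_mult_right[OF has_integral_Re[OF I0], of 2] by simp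
    have "norm (integral {0..2*pi} (\<lambda>t. of_real (2 * Re (g t)) * cis (- (real n * t))))
        \<le> integral {0..2*pi} (\<lambda>t. 2 * Re (g t))"
    proof (rule integral_norm_bound_integral)
      fix t :: real
      have "Re (g t) \<ge> 0" unfolding g_def using r by (intro pos) (simp add: norm_mult)
      then show "norm (of_real (2 * Re (g t)) * cis (- (real n * t))) \<le> 2 * Re (g t)"
        by (simp add: norm_mult)
    qed (use I3 I4 in \<open>auto simp: has_integral_iff\<close>)
    then have "norm (of_real (2 * pi * r ^ n) * c) \<le> 2 * (2 * pi)"
      using I3 I4 by (simp add: has_integral_iff)
    then show ?thesis using r by (simp add: norm_mult norm_power mult_ac)
  qed
  have "((\<lambda>r. norm c * r ^ n) \<longlongrightarrow> norm c * 1 ^ n) (at_left (1::real))"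
    by (intro tendsto_intros)
  moreover have "eventually (\<lambda>r. r \<in> {0<..<1}) (at_left (1::real))"
    by (rule eventually_at_left_real) simp
  then have "eventually (\<lambda>r. norm c * r ^ n \<le> 2) (at_left (1::real))"
    by eventually_elim (use bound in auto)
  ultimately have "norm c * 1 ^ n \<le> 2"
    by (rule tendsto_upperbound) simp
  then show ?thesis by (simp add: c_def)
qed

section \<open>Normalized series and coefficients in \<open>class_R\<close>\<close>

text \<open>Convergence at every point of the disk forces radius of convergence at least 1, where
  termwise differentiation is valid. Differentiability is a conclusion, so the lemma later yields
  the analyticity of the Hadamard product.\<close>

lemma normalized_series_derivative:
  assumes a: "normalized_series f a" and z: "z \<in> unit_disk"
  obtains D where "(f has_field_derivative D) (at z)"
    and "(\<lambda>n. of_nat (n + 2) * a (n + 2) * z ^ (n + 1)) sums (D - 1)"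
proof
  \<comment> \<open>\<open>a 0\<close> and \<open>a 1\<close> are arbitrary, so the true
    coefficients 0 and 1 are put in their place.\<close>
  define F where "F = Abs_fps (\<lambda>n. if n = 0 then 0 else if n = 1 then 1 else a n)"
  have sums: "(\<lambda>n. fps_nth F n * w ^ n) sums f w" if "w \<in> unit_disk" for w
  proof -
    have "(\<lambda>n. fps_nth F (n + 2) * w ^ (n + 2)) sums (f w - (\<Sum>i<2. fps_nth F i * w ^ i))"
      using a that unfolding normalized_series_def F_def by (auto simp: numeral_2_eq_2)
    then show ?thesis by (subst (asm) sums_iff_shift) simp
  qed
  have rad: "fps_conv_radius F \<ge> 1"
    unfolding fps_conv_radius_def
  proof (rule conv_radius_geI_ex)
    fix r :: real assume "0 < r" "ereal r < 1"
    then show "\<exists>w. norm w = r \<and> summable (\<lambda>n. fps_nth F n * w ^ n)"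
      using sums[of "of_real r"] by (intro exI[of _ "of_real r"]) (auto simp: sums_iff)
  qed
  have zF: "ereal (norm z) < fps_conv_radius F"
    using z rad by (auto intro: less_le_trans[of _ 1])
  from has_field_derivative_eval_fps[OF this]
  show "(f has_field_derivative eval_fps (fps_deriv F) z) (at z)"
    by (rule has_field_derivative_transform_within_open[where S = unit_disk])
      (use z sums in \<open>auto simp: eval_fps_def sums_iff\<close>)
  have "(\<lambda>n. fps_nth (fps_deriv F) n * z ^ n) sums eval_fps (fps_deriv F) z"
    using zF fps_conv_radius_deriv[of F] by (intro sums_eval_fps) (rule less_le_trans)
  then have "(\<lambda>n. fps_nth (fps_deriv F) (n + 1) * z ^ (n + 1)) sums (eval_fps (fps_deriv F) z - 1)"
    by (subst sums_iff_shift) (simp add: F_def)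
  then show "(\<lambda>n. of_nat (n + 2) * a (n + 2) * z ^ (n + 1)) sums (eval_fps (fps_deriv F) z - 1)"
    by (simp add: F_def)
qed

text \<open>Caratheodory's inequality for \<open>deriv f\<close>, which is 1 at the origin and whose
  Taylor coefficient of index \<open>n + 1\<close> is \<open>(n + 2) * a (n + 2)\<close>.\<close>

lemma class_R_coefficient_bound:
  assumes f: "f \<in> class_R" and a: "normalized_series f a"
  shows "real (n + 2) * norm (a (n + 2)) \<le> 2"
proof -
  have ana: "f analytic_on unit_disk" and pos: "\<And>z. z \<in> unit_disk \<Longrightarrow> Re (deriv f z) > 0"
    using f by (auto simp: class_R_def class_A_def)
  have d0: "deriv f 0 = 1"
  proof -
    obtain D where D: "(f has_field_derivative D) (at 0)"
      and "(\<lambda>n. of_nat (n + 2) * a (n + 2) * 0 ^ (n + 1)) sums (D - 1)"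
      using normalized_series_derivative[OF a, of 0] by auto
    \<comment> \<open>At the origin every term contains \<open>0 ^ (n + 1) = 0\<close>.\<close>
    then have "(\<lambda>n. 0) sums (D - 1)" by simp
    then have "D = 1" using sums_unique2[OF sums_zero] by fastforce
    with D show ?thesis by (simp add: DERIV_imp_deriv)
  qed
  have "norm ((deriv ^^ (n + 1)) (deriv f) 0 / fact (n + 1)) \<le> 2"
    using ana d0 pos by (intro Caratheodory_coefficient_bound holomorphic_deriv)
      (auto simp: analytic_imp_holomorphic less_imp_le)
  moreover have "a (n + 2) = (deriv ^^ (n + 2)) f 0 / fact (n + 2)"
    using normalized_series_coeff[OF a, of "n + 2"] by (simp add: fps_expansion_def)
  moreover have "(deriv ^^ (n + 2)) f = (deriv ^^ (n + 1)) (deriv f)"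
    by (simp add: funpow_Suc_right del: funpow.simps)
  moreover have "fact (n + 2) = of_nat (n + 2) * (fact (n + 1) :: complex)"
    by (simp add: fact_reduce)
  ultimately have "norm (of_nat (n + 2) * a (n + 2)) \<le> 2"
    by (simp del: funpow.simps fact_Suc of_nat_add)
  then show ?thesis by (simp only: norm_mult norm_of_nat)
qed

section \<open>Hadamard products with geometrically small coefficients\<close>

text \<open>The exponent \<open>n + 1\<close> is the index of \<open>b (n + 2)\<close> as a
  coefficient of \<open>h z / z\<close>. The weight \<open>n + 2\<close> produced by differentiation
  is absorbed by the coefficient bound for \<open>f\<close>.\<close>

lemma hadamard_product_mem:
  assumes f: "f \<in> class_R" and b: "normalized_series h b"
    and bx: "\<And>n. norm (b (n + 2)) \<le> x ^ (n + 1)" and x: "0 \<le> x" "x < 1 / 3"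
  shows "hadamard_product h f \<in> H_infinity \<inter> class_R"
proof -
  obtain a where a: "normalized_series f a"
    using f by (auto simp: class_R_def class_A_def)
  define C where "C n = b n * a n" for n
  define u where "u = hadamard_product h f"
  have wbound: "real (n + 2) * norm (C (n + 2)) \<le> 2 * x ^ (n + 1)" for n
  proof -
    have "norm (b (n + 2)) * (real (n + 2) * norm (a (n + 2))) \<le> x ^ (n + 1) * 2"
      using bx class_R_coefficient_bound[OF f a] x(1) by (intro mult_mono) auto
    then show ?thesis by (simp add: C_def norm_mult mult_ac)
  qed
  have bound: "norm (C (n + 2)) \<le> 2 * x ^ (n + 1)" for n
  proof -
    have "1 * norm (C (n + 2)) \<le> real (n + 2) * norm (C (n + 2))"
      by (intro mult_right_mono) auto
    with wbound[of n] show ?thesis by linarith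
  qed
  have geo: "(\<lambda>n. 2 * x ^ (n + 1)) sums (2 * x / (1 - x))"
    using sums_mult[OF geometric_sums[of x], of "2 * x"] x by (simp add: mult_ac)
  have geo1: "2 * x / (1 - x) < 1"
    using x by (simp add: field_simps)
  have term_le: "norm (d * z ^ k) \<le> B" if "norm d \<le> B" "z \<in> unit_disk" for d z :: complex and k B
  proof -
    have "norm d * norm z ^ k \<le> B * 1"
      using that by (intro mult_mono power_le_one) (auto intro: order_trans[OF norm_ge_zero])
    then show ?thesis by (simp add: norm_mult norm_power)
  qed
  have smbl: "summable (\<lambda>n. C (n + 2) * z ^ (n + 2))" if "z \<in> unit_disk" for z
    by (rule summable_comparison_test'[OF sums_summable[OF geo], of 0]) (rule term_le[OF bound that])
  have u_eq: "u z = z + (\<Sum>n. C (n + 2) * z ^ (n + 2))" for z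
    unfolding u_def hadamard_product_eq[OF b a] by (simp add: C_def)
  have ser: "normalized_series u C"
    using smbl by (auto simp: normalized_series_def u_eq intro: summable_sums)
  have ana: "u analytic_on unit_disk"
    by (subst analytic_on_open) (auto simp: holomorphic_on_open intro: normalized_series_derivative[OF ser])
  have "Re (deriv u z) > 0" if z: "z \<in> unit_disk" for z
  proof -
    obtain D where D: "(u has_field_derivative D) (at z)"
      and S: "(\<lambda>n. of_nat (n + 2) * C (n + 2) * z ^ (n + 1)) sums (D - 1)"
      using normalized_series_derivative[OF ser z] by blast
    have "norm (of_nat (n + 2) * C (n + 2) * z ^ (n + 1)) \<le> 2 * x ^ (n + 1)" for n
      using wbound[of n] z by (intro term_le) (simp_all only: norm_mult norm_of_nat)
    from norm_suminf_le[OF this sums_summable[OF geo]]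
    have "norm (D - 1) \<le> 2 * x / (1 - x)"
      using S geo by (simp add: sums_iff)
    with geo1 have "norm (D - 1) < 1" by linarith
    with abs_Re_le_cmod[of "D - 1"] show ?thesis by (simp add: DERIV_imp_deriv[OF D])
  qed
  \<comment> \<open>One unit comes from the leading term \<open>z\<close>, the other from the
    geometric series that also dominates \<open>u' - 1\<close>.\<close>
  moreover have "norm (u z) \<le> 2" if z: "z \<in> unit_disk" for z
  proof -
    have "norm (\<Sum>n. C (n + 2) * z ^ (n + 2)) \<le> (\<Sum>n. 2 * x ^ (n + 1))"
      by (intro norm_suminf_le term_le bound z sums_summable[OF geo])
    also have "\<dots> \<le> 1" using geo geo1 by (simp add: sums_iff)
    finally have "norm (\<Sum>n. C (n + 2) * z ^ (n + 2)) \<le> 1" .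
    moreover have "norm z \<le> 1" using z by simp
    ultimately show ?thesis unfolding u_eq by norm
  qed
  then have "bounded (u ` unit_disk)" by (intro boundedI[of _ 2]) auto
  ultimately show ?thesis
    using ana ser by (auto simp: H_infinity_def class_R_def class_A_def u_def)
qed

text \<open>Adapts the criterion to the form of \<open>h2_def\<close> and \<open>h3_def\<close>: an
  infinite sum there asserts no convergence, which comparison with the geometric series
  supplies.\<close>

lemma hadamard_product_mem_of_real_coeffs:
  fixes b :: "nat \<Rightarrow> real"
  assumes f: "f \<in> class_R"
    and h: "\<And>z. h z = z + (\<Sum>n. complex_of_real (b (n + 2)) * z ^ (n + 2))"
    and bx: "\<And>n. \<bar>b (n + 2)\<bar> \<le> x ^ (n + 1)" and x: "0 \<le> x" "x < 1 / 3"
  shows "hadamard_product h f \<in> H_infinity \<inter> class_R"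
proof (rule hadamard_product_mem[OF f _ _ x])
  show "norm (complex_of_real (b (n + 2))) \<le> x ^ (n + 1)" for n
    using bx[of n] by simp
  have "summable (\<lambda>n. complex_of_real (b (n + 2)) * z ^ (n + 2))" if z: "z \<in> unit_disk" for z
  proof (rule summable_comparison_test')
    show "summable (\<lambda>n. x ^ (n + 1))"
      using x by (simp add: summable_mult summable_geometric)
    fix n :: nat
    have "\<bar>b (n + 2)\<bar> * norm z ^ (n + 2) \<le> x ^ (n + 1) * 1"
      using bx[of n] x z by (intro mult_mono power_le_one) auto
    then show "norm (complex_of_real (b (n + 2)) * z ^ (n + 2)) \<le> x ^ (n + 1)"
      by (simp add: norm_mult norm_power)
  qed
  then show "normalized_series h (\<lambda>n. complex_of_real (b n))"
    by (auto simp: normalized_series_def h intro: summable_sums)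
qed

section \<open>Lower bounds for q-Pochhammer symbols\<close>

text \<open>Each factor is at least \<open>1 - a\<close>, hence at least \<open>1 - c\<close>. The
  separate \<open>c\<close> lets \<open>q powr \<nu>\<close> stand in for the smaller
  \<open>q powr (\<nu> + 1)\<close>, and \<open>c \<le> 1\<close> keeps the factors compared
  nonnegative.\<close>

lemma q_pochhammer_ge_power:
  assumes "0 < q" "q < 1" "0 \<le> a" "a \<le> c" "c \<le> 1"
  shows "q_pochhammer a q n \<ge> (1 - c) ^ n"
proof -
  have "(\<Prod>k = 1..n. 1 - c) \<le> (\<Prod>k = 1..n. 1 - a * q ^ (k - 1))"
  proof (rule prod_mono)
    fix k
    have "a * q ^ (k - 1) \<le> a * 1"
      using assms by (intro mult_left_mono power_le_one) auto
    then show "0 \<le> 1 - c \<and> 1 - c \<le> 1 - a * q ^ (k - 1)"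
      using assms by auto
  qed
  then show ?thesis by (simp add: q_pochhammer_def)
qed

lemma q_pochhammer_product_ge_power:
  fixes q \<nu> :: real
  assumes "0 < q" "q < 1" "q powr \<nu> < 1"
  shows "((1 - q) * (1 - q powr \<nu>)) ^ n \<le> q_pochhammer q q n * q_pochhammer (q powr (\<nu> + 1)) q n"
proof -
  have "q powr (\<nu> + 1) \<le> q powr \<nu>"
    using assms by (intro powr_mono') auto
  then have "(1 - q powr \<nu>) ^ n \<le> q_pochhammer (q powr (\<nu> + 1)) q n"
    using assms by (intro q_pochhammer_ge_power) auto
  moreover have "(1 - q) ^ n \<le> q_pochhammer q q n"
    using assms by (intro q_pochhammer_ge_power) auto
  ultimately show ?thesis
    unfolding power_mult_distrib using assms
    by (intro mult_mono) (auto intro: order_trans[rotated])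
qed

section \<open>The two q-Bessel functions\<close>

theorem theorem6:
  fixes q \<nu> :: real and f :: "complex \<Rightarrow> complex"
  assumes "0 < q" and "q < 1" and "\<nu> > -1"
    and "f \<in> class_R"
  shows "(4 * (1 - q) * (1 - q powr \<nu>) - 3 * q powr \<nu> > 0
            \<longrightarrow> hadamard_product (h2 \<nu> q) f \<in> H_infinity \<inter> class_R) \<and>
         ((1 - q) * (1 - q powr \<nu>) - 3 * sqrt q > 0
            \<longrightarrow> hadamard_product (h3 \<nu> q) f \<in> H_infinity \<inter> class_R)"
proof (intro conjI impI)
  \<comment> \<open>Both hypotheses bound this quantity from below. Its positivity follows from
    either of them, so the shared facts are conditional on \<open>d > 0\<close>.\<close>
  define d where "d = (1 - q) * (1 - q powr \<nu>)"
  have powr_less: "q powr \<nu> < 1" if "d > 0"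
    using that assms by (simp add: d_def zero_less_mult_iff)
  have poch: "d ^ n \<le> q_pochhammer q q n * q_pochhammer (q powr (\<nu> + 1)) q n" if "d > 0" for n
    unfolding d_def using assms powr_less[OF that] by (intro q_pochhammer_product_ge_power)
  \<comment> \<open>The product is at least \<open>d ^ n > 0\<close>, so the absolute values in the
    coefficient bounds disappear.\<close>
  have abs_poch: "\<bar>q_pochhammer q q n\<bar> * \<bar>q_pochhammer (q powr (\<nu> + 1)) q n\<bar>
      = q_pochhammer q q n * q_pochhammer (q powr (\<nu> + 1)) q n" if "d > 0" for n
    using less_le_trans[OF zero_less_power[OF that] poch[OF that], of n] by (simp flip: abs_mult)
  {
    assume H: "4 * (1 - q) * (1 - q powr \<nu>) - 3 * q powr \<nu> > 0"
    have H': "4 * d > 3 * q powr \<nu>" using H by (simp add: d_def algebra_simps)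
    have d: "d > 0"
      using H' powr_ge_zero[of q \<nu>] by linarith
    show "hadamard_product (h2 \<nu> q) f \<in> H_infinity \<inter> class_R"
    proof (rule hadamard_product_mem_of_real_coeffs[OF assms(4) h2_def])
      \<comment> \<open>With this ratio, \<open>x < 1 / 3\<close> is the hypothesis rearranged to
        \<open>3 * q powr \<nu> < 4 * d\<close>.\<close>
      show "0 \<le> q powr \<nu> / (4 * d)" "q powr \<nu> / (4 * d) < 1 / 3"
        using d H' by (auto simp: field_simps)
      fix n :: nat
      define m where "m = n + 1"
      \<comment> \<open>Since \<open>q < 1\<close>, dropping \<open>m * m\<close> from the exponent
        can only increase the power; what remains is geometric in \<open>m\<close>.\<close>
      have "q powr (real m * (real m + \<nu>)) \<le> q powr (\<nu> * real m)"
        using assms by (intro powr_mono') (auto simp: algebra_simps)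
      also have "\<dots> = (q powr \<nu>) ^ m"
        using assms by (simp add: powr_powr [symmetric] powr_realpow)
      finally have "q powr (real m * (real m + \<nu>)) /
            (4 ^ m * (q_pochhammer q q m * q_pochhammer (q powr (\<nu> + 1)) q m))
          \<le> (q powr \<nu>) ^ m / (4 ^ m * d ^ m)"
        using d poch[OF d, of m] by (intro frac_le mult_left_mono) auto
      then show "\<bar>h2_coeff \<nu> q (n + 2)\<bar> \<le> (q powr \<nu> / (4 * d)) ^ (n + 1)"
        unfolding power_divide power_mult_distrib m_def
        by (simp add: h2_coeff_def abs_mult abs_poch[OF d] mult.assoc mult.left_commute[of d])
    qed
  }
  {
    assume H: "(1 - q) * (1 - q powr \<nu>) - 3 * sqrt q > 0"
    have H': "d > 3 * sqrt q" using H by (simp add: d_def)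
    have d: "d > 0"
      using H' assms real_sqrt_gt_zero[of q] by linarith
    show "hadamard_product (h3 \<nu> q) f \<in> H_infinity \<inter> class_R"
    proof (rule hadamard_product_mem_of_real_coeffs[OF assms(4) h3_def])
      show "0 \<le> sqrt q / d" "sqrt q / d < 1 / 3"
        using d H' assms by (auto simp: field_simps)
      fix n :: nat
      define m where "m = n + 1"
      \<comment> \<open>Again only the part of the exponent linear in \<open>m\<close> is kept,
        namely \<open>m / 2\<close> out of \<open>m * (m + 1) / 2\<close>; this is the source of
        \<open>sqrt q\<close>.\<close>
      have "q powr (1 / 2 * real m * real (m + 1)) \<le> q powr (1 / 2 * real m)"
        using assms by (intro powr_mono') (auto simp: algebra_simps)
      also have "\<dots> = sqrt q ^ m"
        using assms by (simp add: powr_half_sqrt [symmetric] powr_power)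
      finally have "q powr (1 / 2 * real m * real (m + 1)) /
            (q_pochhammer q q m * q_pochhammer (q powr (\<nu> + 1)) q m)
          \<le> sqrt q ^ m / d ^ m"
        using d poch[OF d, of m] assms by (intro frac_le) auto
      then show "\<bar>h3_coeff \<nu> q (n + 2)\<bar> \<le> (sqrt q / d) ^ (n + 1)"
        by (simp add: h3_coeff_def m_def power_divide abs_mult abs_poch[OF d])
    qed
  }
qed

end
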